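(* Let $\alpha\in(0,1)$, $\delta_0>0$ and $\delta>12\delta_0$, and define $$\theta_{s,1}=\frac{2\delta_0}{(1-\alpha)\delta},\qquad \theta_{s,2}=\left(\frac{6\delta_0}{(1-\alpha)\delta}\right)^{1/2},\qquad \theta_{f,1}=\frac{4\delta_0}{\delta},\qquad \theta_{f,2}=\left(\frac{12\delta_0}{\delta}\right)^{1/2}.$$ Let $t_0<t_1<\dots<t_k$ with $k\ge2$ be real numbers, put $\tau_j=t_j-t_{j-1}$, let $1\le j\le k-1$, set $\theta=\tau_j/(t_k-t_{j-1})$, let $\vartheta_\ell>0$, and let $M_1,M_2,N_1,N_2\ge1$ be integers. Let $I_i,J_i$ and their truncated Taylor approximations $\hat I_i,\hat J_i$ ($i=1,2$) be as defined in the context. If, for $i=1,2$, $$\frac{\tau_j}{t_k-t_{j-1}}\le\theta_{s,i}\qquad\text{and}\qquad \vartheta_\ell\,\tau_{k-1}\le\theta_{f,i},$$ then the relative errors $\delta I_i=(\hat I_i-I_i)/I_i$ and $\delta J_i=(\hat J_i-J_i)/J_i$ satisfy $$|\delta I_i|<\theta^{M_i},\qquad |\delta J_i|<(\vartheta_\ell\tau_{k-1})^{N_i},\qquad i=1,2 .$$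
   Context: For a mesh $t_0<t_1<\dots<t_k$ with steps $\tau_j=t_j-t_{j-1}$, an index $1\le j\le k-1$, $\theta=\tau_j/(t_k-t_{j-1})\in(0,1)$, and a positive number $\vartheta_\ell$ (a quadrature node of a sum-of-exponentials approximation; $\ell$ is an index), define $$I_1=(t_k-t_{j-1})^{1-\alpha}-(t_k-t_j)^{1-\alpha},$$ $$I_2=(2-\alpha)\tau_j(t_k-t_{j-1})^{1-\alpha}+(t_k-t_j)^{2-\alpha}-(t_k-t_{j-1})^{2-\alpha},$$ $$J_1=1-e^{-\vartheta_\ell\tau_{k-1}},\qquad J_2=1-\vartheta_\ell\tau_{k-1}e^{-\vartheta_\ell\tau_{k-1}}-e^{-\vartheta_\ell\tau_{k-1}}.$$ All four quantities are positive. For integers $M_1,M_2,N_1,N_2\ge1$ (truncation numbers), define $$\hat I_1=-(t_k-t_{j-1})^{1-\alpha}\sum_{m=1}^{M_1}\binom{1-\alpha}{m}(-\theta)^m,\qquad \hat I_2=(t_k-t_{j-1})^{2-\alpha}\sum_{m=2}^{M_2+1}\binom{2-\alpha}{m}(-\theta)^m,$$ $$\hat J_1=e^{-\vartheta_\ell\tau_{k-1}}\sum_{m=1}^{N_1}\frac{(\vartheta_\ell\tau_{k-1})^m}{m!},\qquad \hat J_2=e^{-\vartheta_\ell\tau_{k-1}}\sum_{m=2}^{N_2+1}\frac{(\vartheta_\ell\tau_{k-1})^m}{m!},$$ where $\binom{a}{m}=a(a-1)\cdots(a-m+1)/m!$ is the generalized binomial coefficient. *)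

theory Defs
  imports Complex_Main
begin

text \<open>
  A mesh is a function on \<^typ>\<open>nat\<close> of which only the values \<open>t 0, \<dots>, t k\<close> matter.
  In every definition below, \<open>j\<close> and \<open>k\<close> are meant to satisfy \<open>1 \<le> j \<le> k - 1\<close>, so that no
  subtraction on \<^typ>\<open>nat\<close> is truncated and all bases of \<open>powr\<close> are positive.
\<close>

definition step :: "(nat \<Rightarrow> real) \<Rightarrow> nat \<Rightarrow> real" where
  "step t j = t j - t (j - 1)"

definition ratio :: "(nat \<Rightarrow> real) \<Rightarrow> nat \<Rightarrow> nat \<Rightarrow> real" where
  "ratio t k j = step t j / (t k - t (j - 1))"

definition I1 :: "real \<Rightarrow> (nat \<Rightarrow> real) \<Rightarrow> nat \<Rightarrow> nat \<Rightarrow> real" where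
  "I1 \<alpha> t k j = (t k - t (j - 1)) powr (1 - \<alpha>) - (t k - t j) powr (1 - \<alpha>)"

definition I2 :: "real \<Rightarrow> (nat \<Rightarrow> real) \<Rightarrow> nat \<Rightarrow> nat \<Rightarrow> real" where
  "I2 \<alpha> t k j = (2 - \<alpha>) * step t j * (t k - t (j - 1)) powr (1 - \<alpha>)
     + (t k - t j) powr (2 - \<alpha>) - (t k - t (j - 1)) powr (2 - \<alpha>)"

text \<open>The argument \<open>v\<close> is the quadrature node \<open>\<vartheta>\<^sub>l\<close>.\<close>

definition J1 :: "(nat \<Rightarrow> real) \<Rightarrow> nat \<Rightarrow> real \<Rightarrow> real" where
  "J1 t k v = 1 - exp (- (v * step t (k - 1)))"

definition J2 :: "(nat \<Rightarrow> real) \<Rightarrow> nat \<Rightarrow> real \<Rightarrow> real" where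
  "J2 t k v = 1 - v * step t (k - 1) * exp (- (v * step t (k - 1)))
     - exp (- (v * step t (k - 1)))"

definition I1_hat :: "real \<Rightarrow> (nat \<Rightarrow> real) \<Rightarrow> nat \<Rightarrow> nat \<Rightarrow> nat \<Rightarrow> real" where
  "I1_hat \<alpha> t k j M = - ((t k - t (j - 1)) powr (1 - \<alpha>))
     * (\<Sum>m = 1..M. ((1 - \<alpha>) gchoose m) * (- ratio t k j) ^ m)"

definition I2_hat :: "real \<Rightarrow> (nat \<Rightarrow> real) \<Rightarrow> nat \<Rightarrow> nat \<Rightarrow> nat \<Rightarrow> real" where
  "I2_hat \<alpha> t k j M = (t k - t (j - 1)) powr (2 - \<alpha>)
     * (\<Sum>m = 2..M + 1. ((2 - \<alpha>) gchoose m) * (- ratio t k j) ^ m)"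

definition J1_hat :: "(nat \<Rightarrow> real) \<Rightarrow> nat \<Rightarrow> real \<Rightarrow> nat \<Rightarrow> real" where
  "J1_hat t k v N = exp (- (v * step t (k - 1)))
     * (\<Sum>m = 1..N. (v * step t (k - 1)) ^ m / fact m)"

definition J2_hat :: "(nat \<Rightarrow> real) \<Rightarrow> nat \<Rightarrow> real \<Rightarrow> nat \<Rightarrow> real" where
  "J2_hat t k v N = exp (- (v * step t (k - 1)))
     * (\<Sum>m = 2..N + 1. (v * step t (k - 1)) ^ m / fact m)"

definition rel_err :: "real \<Rightarrow> real \<Rightarrow> real" where
  "rel_err approx exact = (approx - exact) / exact"

text \<open>The thresholds \<open>\<theta>\<^sub>s\<^sub>,\<^sub>i\<close> and \<open>\<theta>\<^sub>f\<^sub>,\<^sub>i\<close>; \<open>\<delta>0\<close> and \<open>\<delta>\<close> are the parameters of the theorem.\<close>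

definition theta_s1 :: "real \<Rightarrow> real \<Rightarrow> real \<Rightarrow> real" where
  "theta_s1 \<alpha> \<delta>0 \<delta> = 2 * \<delta>0 / ((1 - \<alpha>) * \<delta>)"

definition theta_s2 :: "real \<Rightarrow> real \<Rightarrow> real \<Rightarrow> real" where
  "theta_s2 \<alpha> \<delta>0 \<delta> = sqrt (6 * \<delta>0 / ((1 - \<alpha>) * \<delta>))"

definition theta_f1 :: "real \<Rightarrow> real \<Rightarrow> real" where
  "theta_f1 \<delta>0 \<delta> = 4 * \<delta>0 / \<delta>"

definition theta_f2 :: "real \<Rightarrow> real \<Rightarrow> real" where
  "theta_f2 \<delta>0 \<delta> = sqrt (12 * \<delta>0 / \<delta>)"

end

theory Submission
  imports Defs "HOL-Analysis.Generalised_Binomial_Theorem"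
begin

text \<open>
  Up to a positive factor, each of the four exact quantities is a power series
  \<open>\<Sum>m\<ge>p. c m * x ^ m\<close> with positive, strictly decreasing coefficients, and its approximation
  keeps the terms of index below \<open>p + M\<close>. Shifting the index by \<open>M\<close> in the remainder
  gives \<open>x ^ M * (\<Sum>m\<ge>p. c (m + M) * x ^ m)\<close>, which is smaller than \<open>x ^ M\<close> times the
  exact value.
\<close>

lemma rel_err_truncated_power_series:
  fixes c :: "nat \<Rightarrow> real" and x C S :: real
  assumes sums: "(\<lambda>m. c m * x ^ m) sums S"
    and "0 < x" "0 < M" "0 < C"
    and pos: "\<And>m. p \<le> m \<Longrightarrow> 0 < c m"
    and dec: "\<And>m. p \<le> m \<Longrightarrow> c (Suc m) < c m"
  shows "\<bar>rel_err (C * (\<Sum>m = p..<p + M. c m * x ^ m))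
            (C * (S - (\<Sum>m<p. c m * x ^ m)))\<bar> < x ^ M"
proof -
  define f where "f m = c m * x ^ m" for m
  define E where "E = (\<Sum>m. f (m + p))"
  define R where "R = (\<Sum>m. f (m + (p + M)))"
  have summable: "summable f"
    using sums by (simp add: f_def[abs_def] sums_iff)
  have S_eq: "S = suminf f"
    using sums by (simp add: f_def[abs_def] sums_iff)
  have E_eq: "E = S - (\<Sum>m<p. f m)"
    unfolding E_def S_eq using summable by (rule suminf_minus_initial_segment)
  have "R = S - (\<Sum>m<p + M. f m)"
    unfolding R_def S_eq using summable by (rule suminf_minus_initial_segment)
  also have "(\<Sum>m<p + M. f m) = (\<Sum>m<p. f m) + (\<Sum>m = p..<p + M. f m)"
    by (simp add: lessThan_atLeast0 sum.atLeastLessThan_concat)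
  finally have trunc: "(\<Sum>m = p..<p + M. f m) = E - R"
    by (simp add: E_eq)
  have summable_tail: "summable (\<lambda>m. f (m + n))" for n
    using summable by (simp add: summable_iff_shift)
  have f_pos: "0 < f m" if "p \<le> m" for m
    using pos[OF that] \<open>0 < x\<close> by (simp add: f_def)
  have E_pos: "0 < E"
    unfolding E_def using summable_tail f_pos by (intro suminf_pos) auto
  have R_pos: "0 < R"
    unfolding R_def using summable_tail f_pos by (intro suminf_pos) auto
  \<comment> \<open>Iterates \<open>dec\<close> over \<open>n\<close> steps; strictness needs
    \<open>0 < n\<close>, which is where \<open>0 < M\<close> enters.\<close>
  have c_less: "c (m + n) < c m" if "p \<le> m" "0 < n" for m n
    using that(2)
  proof (induction n rule: nat_induct_non_zero)
    case 1
    then show ?case using dec that(1) by simp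
  next
    case (Suc n)
    then show ?case using dec[of "m + n"] that(1) by simp
  qed
  \<comment> \<open>Summing the positive termwise differences as one series keeps the inequality
    strict in the limit.\<close>
  have "0 < (\<Sum>m. x ^ M * f (m + p) - f (m + (p + M)))"
  proof (rule suminf_pos)
    show "summable (\<lambda>m. x ^ M * f (m + p) - f (m + (p + M)))"
      by (intro summable_diff summable_mult summable_tail)
    fix m
    have "x ^ M * f (m + p) - f (m + (p + M)) = (c (m + p) - c (m + p + M)) * x ^ (m + p + M)"
      by (simp add: f_def power_add algebra_simps)
    also have "\<dots> > 0"
      using c_less[of "m + p" M] \<open>0 < x\<close> \<open>0 < M\<close> by simp
    finally show "0 < x ^ M * f (m + p) - f (m + (p + M))" .
  qed
  also have "\<dots> = x ^ M * E - R"
    unfolding E_def R_def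
    by (subst suminf_diff[symmetric])
       (simp_all only: suminf_mult summable_mult summable_tail)
  finally have "R < x ^ M * E" by simp
  \<comment> \<open>The factor \<open>C\<close> cancels, and only the ratio of the remainder to the
    exact value is left.\<close>
  moreover have "rel_err (C * (E - R)) (C * E) = - (R / E)"
    using \<open>0 < C\<close> E_pos by (simp add: rel_err_def field_simps)
  ultimately have "\<bar>rel_err (C * (E - R)) (C * E)\<bar> < x ^ M"
    using E_pos R_pos by (simp only: abs_minus_cancel) (simp add: pos_divide_less_eq)
  then show ?thesis
    unfolding trunc[symmetric] unfolding E_eq f_def .
qed

text \<open>Both absorption identities have the right-hand side
  \<open>a * ((a - 1) gchoose m)\<close>. The sign turns \<open>a - m\<close> into
  \<open>m - a\<close>, so the ratio of consecutive coefficients lies in (0,1) as soon as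
  \<open>m > a > -1\<close>.\<close>

lemma gchoose_alternating_Suc:
  "((a::real) gchoose Suc m) * (- 1) ^ Suc m
     = (a gchoose m) * (- 1) ^ m * ((real m - a) / (real m + 1))"
proof -
  have "(real m + 1) * (a gchoose Suc m) = (a - real m) * (a gchoose m)"
    using gbinomial_absorb_comp[of a m] gbinomial_absorption[of m a]
    by (simp add: algebra_simps)
  then have eq: "(a gchoose Suc m) = (a - real m) * (a gchoose m) / (real m + 1)"
    by (simp add: field_simps)
  show ?thesis unfolding eq by (simp add: diff_divide_distrib algebra_simps)
qed

text \<open>Newton's series at \<open>- x\<close>, with the sign moved into the coefficients so that
  the variable stays positive.\<close>

lemma alternating_binomial_sums:
  fixes a x :: real
  assumes "0 < x" "x < 1"
  shows "(\<lambda>m. (a gchoose m) * (- 1) ^ m * x ^ m) sums (1 - x) powr a"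
proof -
  have "(\<lambda>m. (a gchoose m) * (- x) ^ m) sums (1 + - x) powr a"
    using assms by (intro gen_binomial_real) simp
  then show ?thesis by (simp add: power_minus[of x] mult.assoc)
qed

text \<open>The factor \<open>s\<close> makes the coefficient at \<open>p\<close> positive. From
  there on the ratio of consecutive coefficients is positive because \<open>a < p\<close>, which
  preserves the sign, and below 1 because \<open>-1 < a\<close>, which gives the decrease.\<close>

lemma rel_err_truncated_binomial:
  fixes a x s :: real
  assumes "0 < x" "x < 1" "0 < M" "0 < C" "- 1 < a" "a < real p"
    and start: "0 < s * ((a gchoose p) * (- 1) ^ p)"
  shows "\<bar>rel_err (C * (\<Sum>m = p..<p + M. s * ((a gchoose m) * (- 1) ^ m) * x ^ m))
      (C * (s * (1 - x) powr a - (\<Sum>m<p. s * ((a gchoose m) * (- 1) ^ m) * x ^ m)))\<bar> < x ^ M"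
proof (rule rel_err_truncated_power_series)
  let ?c = "\<lambda>m. s * ((a gchoose m) * (- 1) ^ m)"
  show "(\<lambda>m. ?c m * x ^ m) sums (s * (1 - x) powr a)"
    using sums_mult[OF alternating_binomial_sums[OF assms(1,2)], of s a] by (simp add: mult.assoc)
  have rec: "?c (Suc m) = ?c m * ((real m - a) / (real m + 1))" for m
    by (simp only: gchoose_alternating_Suc mult.assoc)
  show c_pos: "0 < ?c m" if "p \<le> m" for m
    using that
  proof (induction m rule: dec_induct)
    case base
    show ?case by (fact start)
  next
    case (step m)
    then have "0 < (real m - a) / (real m + 1)"
      using \<open>a < real p\<close> by simp
    with step.IH show ?case unfolding rec by (rule mult_pos_pos)
  qed
  show "?c (Suc m) < ?c m" if "p \<le> m" for m
  proof -
    have "(real m - a) / (real m + 1) < 1"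
      using \<open>- 1 < a\<close> by (simp add: field_simps)
    then show ?thesis
      unfolding rec using mult_strict_left_mono[OF _ c_pos[OF that], of _ 1] by (simp only: mult_1_right)
  qed
qed (use assms in auto)

text \<open>The coefficients are inverse factorials. They decrease strictly only from index 1 on,
  since 0! = 1!; hence \<open>0 < p\<close>.\<close>

lemma rel_err_truncated_exp:
  fixes x :: real
  assumes "0 < x" "0 < M" "0 < C" "0 < p"
  shows "\<bar>rel_err (C * (\<Sum>m = p..<p + M. x ^ m / fact m))
            (C * (exp x - (\<Sum>m<p. x ^ m / fact m)))\<bar> < x ^ M"
proof -
  have "\<bar>rel_err (C * (\<Sum>m = p..<p + M. inverse (fact m) * x ^ m))
      (C * (exp x - (\<Sum>m<p. inverse (fact m) * x ^ m)))\<bar> < x ^ M"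
  proof (rule rel_err_truncated_power_series)
    show "(\<lambda>m. inverse (fact m) * x ^ m) sums exp x"
      using exp_converges[of x] by simp
    show "inverse (fact (Suc m)) < (inverse (fact m) :: real)" if "p \<le> m" for m
      using that \<open>0 < p\<close> by (intro less_imp_inverse_less fact_less_mono) auto
  qed (use assms in auto)
  then show ?thesis by (simp add: field_class.field_divide_inverse mult.commute)
qed

theorem theorem3p3:
  fixes \<alpha> \<delta>0 \<delta> v :: real
    and t :: "nat \<Rightarrow> real"
    and k j M1 M2 N1 N2 :: nat
  assumes "0 < \<alpha>" and "\<alpha> < 1"
    and "\<delta>0 > 0" and "\<delta> > 12 * \<delta>0"
    and "k \<ge> 2" and "strict_mono_on {0..k} t"
    and "1 \<le> j" and "j \<le> k - 1"
    and "v > 0"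
    and "M1 \<ge> 1" and "M2 \<ge> 1" and "N1 \<ge> 1" and "N2 \<ge> 1"
    and "ratio t k j \<le> theta_s1 \<alpha> \<delta>0 \<delta>"
    and "ratio t k j \<le> theta_s2 \<alpha> \<delta>0 \<delta>"
    and "v * step t (k - 1) \<le> theta_f1 \<delta>0 \<delta>"
    and "v * step t (k - 1) \<le> theta_f2 \<delta>0 \<delta>"
  shows "\<bar>rel_err (I1_hat \<alpha> t k j M1) (I1 \<alpha> t k j)\<bar> < ratio t k j ^ M1
    \<and> \<bar>rel_err (I2_hat \<alpha> t k j M2) (I2 \<alpha> t k j)\<bar> < ratio t k j ^ M2
    \<and> \<bar>rel_err (J1_hat t k v N1) (J1 t k v)\<bar> < (v * step t (k - 1)) ^ N1
    \<and> \<bar>rel_err (J2_hat t k v N2) (J2 t k v)\<bar> < (v * step t (k - 1)) ^ N2"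
proof (intro conjI)
  define T where "T = t k - t (j - 1)"
  define \<theta> where "\<theta> = ratio t k j"
  define x where "x = v * step t (k - 1)"
  have mono: "t m < t n" if "m < n" "n \<le> k" for m n
    using \<open>strict_mono_on {0..k} t\<close> that by (auto simp: strict_mono_on_def)
  have "0 < T"
    using mono[of "j - 1" k] \<open>1 \<le> j\<close> \<open>j \<le> k - 1\<close> by (simp add: T_def)
  have "0 < step t j" "step t j < T"
    using mono[of "j - 1" j] mono[of j k] \<open>1 \<le> j\<close> \<open>j \<le> k - 1\<close> by (auto simp: T_def step_def)
  \<comment> \<open>Strictness comes from \<open>j < k\<close> and puts \<open>\<theta>\<close>
    inside the disc of convergence of the binomial series.\<close>
  then have "0 < \<theta>" "\<theta> < 1"
    using \<open>0 < T\<close> unfolding \<theta>_def ratio_def T_def[symmetric] by simp_all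
  have step_eq: "step t j = T * \<theta>"
    using \<open>0 < T\<close> unfolding \<theta>_def ratio_def T_def[symmetric] by simp
  \<comment> \<open>Scaling by \<open>T\<close> turns every power of the mesh distances into a power
    of \<open>T\<close> times a function of \<open>\<theta>\<close> alone.\<close>
  have "t k - t j = T * (1 - \<theta>)"
    using step_eq by (simp add: T_def step_def algebra_simps)
  then have powr_eq: "(t k - t j) powr a = T powr a * (1 - \<theta>) powr a" for a
    using \<open>0 < T\<close> \<open>\<theta> < 1\<close> by (simp add: powr_mult)
  have "0 < x"
    using mono[of "k - 1 - 1" "k - 1"] \<open>2 \<le> k\<close> \<open>0 < v\<close> by (simp add: x_def step_def)

  \<comment> \<open>Here \<open>p = 1\<close>: only the constant term 1 is removed. The next
    coefficient is \<open>- (1 - \<alpha>) < 0\<close>, so \<open>s = -1\<close>.\<close>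
  have I1: "I1 \<alpha> t k j = T powr (1 - \<alpha>) * (1 - (1 - \<theta>) powr (1 - \<alpha>))"
    unfolding I1_def T_def[symmetric] powr_eq by (simp add: algebra_simps)
  have I1_hat: "I1_hat \<alpha> t k j M1 = T powr (1 - \<alpha>) *
      (\<Sum>m = 1..<1 + M1. - 1 * (((1 - \<alpha>) gchoose m) * (- 1) ^ m) * \<theta> ^ m)"
    unfolding I1_hat_def T_def[symmetric] \<theta>_def[symmetric]
    by (simp add: atLeastLessThanSuc_atLeastAtMost power_minus[of \<theta>] sum_negf mult.assoc)
  show "\<bar>rel_err (I1_hat \<alpha> t k j M1) (I1 \<alpha> t k j)\<bar> < ratio t k j ^ M1"
    using rel_err_truncated_binomial[of \<theta> M1 "T powr (1 - \<alpha>)" "1 - \<alpha>" 1 "- 1"]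
      \<open>0 < \<theta>\<close> \<open>\<theta> < 1\<close> \<open>0 < T\<close> \<open>0 < \<alpha>\<close> \<open>\<alpha> < 1\<close> \<open>1 \<le> M1\<close>
    unfolding I1 I1_hat \<theta>_def[symmetric] by simp

  have "T powr (2 - \<alpha>) = T * T powr (1 - \<alpha>)"
    using \<open>0 < T\<close> powr_mult_base[of T "1 - \<alpha>"] by simp
  \<comment> \<open>Here \<open>p = 2\<close>: the subtracted affine part is the sum of the terms of
    index 0 and 1 in the series of \<open>(1 - \<theta>) powr (2 - \<alpha>)\<close>.\<close>
  then have I2: "I2 \<alpha> t k j
      = T powr (2 - \<alpha>) * ((1 - \<theta>) powr (2 - \<alpha>) - ((\<alpha> - 2) * \<theta> + 1))"
    unfolding I2_def T_def[symmetric] powr_eq step_eq by (simp add: algebra_simps)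
  have I2_hat: "I2_hat \<alpha> t k j M2 = T powr (2 - \<alpha>) *
      (\<Sum>m = 2..<2 + M2. 1 * (((2 - \<alpha>) gchoose m) * (- 1) ^ m) * \<theta> ^ m)"
    unfolding I2_hat_def T_def[symmetric] \<theta>_def[symmetric]
    by (simp add: atLeastLessThanSuc_atLeastAtMost power_minus[of \<theta>] mult.assoc)
  \<comment> \<open>This leading coefficient is positive for \<open>\<alpha> < 1\<close>, so
    \<open>s = 1\<close>.\<close>
  have gchoose_2: "(2 - \<alpha>) gchoose 2 = (2 - \<alpha>) * (1 - \<alpha>) / 2"
    by (simp add: gbinomial_prod_rev numeral_2_eq_2)
  show "\<bar>rel_err (I2_hat \<alpha> t k j M2) (I2 \<alpha> t k j)\<bar> < ratio t k j ^ M2"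
    using rel_err_truncated_binomial[of \<theta> M2 "T powr (2 - \<alpha>)" "2 - \<alpha>" 2 1]
      \<open>0 < \<theta>\<close> \<open>\<theta> < 1\<close> \<open>0 < T\<close> \<open>0 < \<alpha>\<close> \<open>\<alpha> < 1\<close> \<open>1 \<le> M2\<close>
    unfolding I2 I2_hat \<theta>_def[symmetric]
    by (simp add: gchoose_2 lessThan_nat_numeral lessThan_Suc)

  \<comment> \<open>Factoring out \<open>exp (- x)\<close> exposes the tail of the series of
    \<open>exp x\<close> from index 1, all of whose terms are positive.\<close>
  have J1: "J1 t k v = exp (- x) * (exp x - 1)"
    unfolding J1_def x_def[symmetric] by (simp add: right_diff_distrib flip: exp_add)
  show "\<bar>rel_err (J1_hat t k v N1) (J1 t k v)\<bar> < (v * step t (k - 1)) ^ N1"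
    using rel_err_truncated_exp[of x N1 "exp (- x)" 1] \<open>0 < x\<close> \<open>1 \<le> N1\<close>
    unfolding J1 J1_hat_def x_def[symmetric] by (simp add: atLeastLessThanSuc_atLeastAtMost)

  \<comment> \<open>The same factorization, now with the tail from index 2.\<close>
  have J2: "J2 t k v = exp (- x) * (exp x - (x + 1))"
    unfolding J2_def x_def[symmetric] by (simp add: algebra_simps flip: exp_add)
  show "\<bar>rel_err (J2_hat t k v N2) (J2 t k v)\<bar> < (v * step t (k - 1)) ^ N2"
    using rel_err_truncated_exp[of x N2 "exp (- x)" 2] \<open>0 < x\<close> \<open>1 \<le> N2\<close>
    unfolding J2 J2_hat_def x_def[symmetric]
    by (simp add: atLeastLessThanSuc_atLeastAtMost lessThan_nat_numeral lessThan_Suc)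
qed

end
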